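(* Let $\mu$ be a probability distribution on $\mathbb{Z}_{\ge 0}$ with $\mu(0)>0$, $\mu(1)>0$ and $\mu(2)>0$. Let $(k_n)$ be a sequence of positive integers with $k_n\to\infty$ and $k_n=o(n)$ as $n\to\infty$. Let $T_n^{k_n}$ be a $\mu$-Bienaymé–Galton–Watson tree conditioned to have $n$ vertices and $k_n$ leaves. Then, with probability tending to $1$ as $n\to\infty$, $$\phi_2\left(T_n^{k_n}\right)\sim k_n\qquad\text{and}\qquad \phi_1\left(T_n^{k_n}\right)=n-2k_n+o(k_n),$$ that is, for every $\varepsilon>0$, $$\mathbb{P}\left(\left|\phi_2(T_n^{k_n})-k_n\right|\le \varepsilon k_n \text{ and } \left|\phi_1(T_n^{k_n})-(n-2k_n)\right|\le \varepsilon k_n\right)\xrightarrow[n\to\infty]{}1 .$$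
   Context: A tree means a rooted planar (ordered) tree. A vertex with no children is a leaf. For a finite tree $t$ and $i\ge0$, $\phi_i(t)$ is the number of vertices of $t$ having exactly $i$ children. A $\mu$-Bienaymé–Galton–Watson (BGW) tree $T$ is the random rooted planar tree in which the numbers of children of the vertices are i.i.d. with law $\mu$; in particular $\mathbb{P}(T=\tau)=\prod_{u\in\tau}\mu(c_u(\tau))$ for every finite tree $\tau$, where $c_u(\tau)$ is the number of children of $u$ in $\tau$. $T_n^{k_n}$ has the law of $T$ conditioned on the event that $T$ has $n$ vertices and $k_n$ leaves, and is considered for those $n$ for which this event has positive probability (this is the case for all $n$ large enough). *)

theory Defs
  imports "HOL-Probability.Probability" "HOL-Library.Landau_Symbols"
begin

text \<open>
  Rooted planar trees in Ulam--Harris notation: a vertex is the word of the birth ranks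
  (counted from 0) met on the path from the root \<open>[]\<close>; the children of \<open>u\<close> are
  \<open>u @ [0], u @ [1], \<dots>\<close>. Infinite trees are allowed, infinite degrees are not.
\<close>

definition plane_tree :: "nat list set \<Rightarrow> bool" where
  "plane_tree t \<longleftrightarrow> [] \<in> t
     \<and> (\<forall>u j. u @ [j] \<in> t \<longrightarrow> u \<in> t \<and> (\<forall>i<j. u @ [i] \<in> t))
     \<and> (\<forall>u\<in>t. finite {j. u @ [j] \<in> t})"

definition num_children :: "nat list set \<Rightarrow> nat list \<Rightarrow> nat" where
  "num_children t u = card {j. u @ [j] \<in> t}"

definition \<phi> :: "nat \<Rightarrow> nat list set \<Rightarrow> nat" where
  "\<phi> i t = card {u \<in> t. num_children t u = i}"

text \<open>The leaves of \<open>t\<close> are counted by \<open>\<phi> 0 t\<close>.\<close>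

definition has_size :: "nat \<Rightarrow> nat \<Rightarrow> nat list set \<Rightarrow> bool" where
  "has_size n k t \<longleftrightarrow> finite t \<and> card t = n \<and> \<phi> 0 t = k"

text \<open>The plane tree in which every vertex \<open>u\<close> has \<open>c u\<close> children.\<close>

inductive_set tree_of :: "(nat list \<Rightarrow> nat) \<Rightarrow> nat list set" for c where
  root: "[] \<in> tree_of c"
| child: "u \<in> tree_of c \<Longrightarrow> j < c u \<Longrightarrow> u @ [j] \<in> tree_of c"

text \<open>
  The offspring variables \<open>\<xi> u\<close> are indexed by all words; those of words outside the
  tree play no role.
\<close>

definition BGW_tree :: "'w measure \<Rightarrow> nat pmf \<Rightarrow> ('w \<Rightarrow> nat list set) \<Rightarrow> bool" where
  "BGW_tree M \<mu> T \<longleftrightarrow> (\<exists>\<xi> :: nat list \<Rightarrow> 'w \<Rightarrow> nat.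
     prob_space.indep_vars M (\<lambda>_. count_space UNIV) \<xi> UNIV
     \<and> (\<forall>u. distr M (count_space UNIV) (\<xi> u) = measure_pmf \<mu>)
     \<and> (\<forall>\<omega>\<in>space M. T \<omega> = tree_of (\<lambda>u. \<xi> u \<omega>)))"

lemma snoc_in_tree_of_iff: "u @ [j] \<in> tree_of c \<longleftrightarrow> u \<in> tree_of c \<and> j < c u"
  by (subst tree_of.simps) auto

lemma plane_tree_tree_of: "plane_tree (tree_of c)"
  by (auto simp: plane_tree_def snoc_in_tree_of_iff root)

lemma num_children_tree_of: "u \<in> tree_of c \<Longrightarrow> num_children (tree_of c) u = c u"
  by (simp add: num_children_def snoc_in_tree_of_iff)

lemma plane_tree_children:
  assumes "plane_tree t" "u \<in> t"
  shows "u @ [j] \<in> t \<longleftrightarrow> j < num_children t u"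
proof -
  let ?S = "{j. u @ [j] \<in> t}"
  have fin: "finite ?S" and down: "\<And>i j. j \<in> ?S \<Longrightarrow> i < j \<Longrightarrow> i \<in> ?S"
    using assms by (auto simp: plane_tree_def)
  have "?S = {..<card ?S}"
  proof (rule card_subset_eq[symmetric])
    show "{..<card ?S} \<subseteq> ?S"
    proof
      fix i assume i: "i \<in> {..<card ?S}"
      show "i \<in> ?S"
      proof (rule ccontr)
        assume "i \<notin> ?S"
        then have "?S \<subseteq> {..<i}"
          using down by (metis lessThan_iff linorder_neqE_nat subsetI)
        then have "card ?S \<le> i"
          using card_mono[of "{..<i}" ?S] by simp
        with i show False by simp
      qed
    qed
  qed (use fin in auto)
  then show ?thesis unfolding num_children_def by blast
qed

lemma tree_of_eq_iff:
  assumes t: "plane_tree t"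
  shows "tree_of c = t \<longleftrightarrow> (\<forall>u\<in>t. c u = num_children t u)"
proof
  assume "tree_of c = t"
  then show "\<forall>u\<in>t. c u = num_children t u"
    using num_children_tree_of by metis
next
  assume c: "\<forall>u\<in>t. c u = num_children t u"
  have "u \<in> tree_of c \<longleftrightarrow> u \<in> t" for u
  proof (induction u rule: rev_induct)
    case Nil
    then show ?case using t by (simp add: root plane_tree_def)
  next
    case (snoc j u)
    have "u @ [j] \<in> t \<Longrightarrow> u \<in> t" using t by (auto simp: plane_tree_def)
    then show ?case
      using snoc c plane_tree_children[OF t, of u j] by (auto simp: snoc_in_tree_of_iff)
  qed
  then show "tree_of c = t" by blast
qed

lemma prob_BGW_tree_eq:
  assumes "prob_space M" "BGW_tree M \<mu> T" "plane_tree \<tau>" "finite \<tau>"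
  shows "\<P>(\<omega> in M. T \<omega> = \<tau>) = (\<Prod>u\<in>\<tau>. pmf \<mu> (num_children \<tau> u))"
proof -
  interpret prob_space M by fact
  obtain \<xi> :: "nat list \<Rightarrow> 'a \<Rightarrow> nat" where
    ind: "indep_vars (\<lambda>_. count_space UNIV) \<xi> UNIV" and
    law: "\<And>u. distr M (count_space UNIV) (\<xi> u) = measure_pmf \<mu>" and
    T: "\<And>\<omega>. \<omega> \<in> space M \<Longrightarrow> T \<omega> = tree_of (\<lambda>u. \<xi> u \<omega>)"
    using assms(2) unfolding BGW_tree_def by blast
  have ne: "\<tau> \<noteq> {}" using assms(3) by (auto simp: plane_tree_def)
  have rv: "\<xi> u \<in> measurable M (count_space UNIV)" for u
    using ind by (simp add: indep_vars_def)
  have T_iff: "T \<omega> = \<tau> \<longleftrightarrow> (\<forall>u\<in>\<tau>. \<xi> u \<omega> = num_children \<tau> u)" if "\<omega> \<in> space M" for \<omega>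
    using T[OF that] tree_of_eq_iff[OF assms(3)] by simp
  have "{\<omega> \<in> space M. T \<omega> = \<tau>} = (\<Inter>u\<in>\<tau>. \<xi> u -` {num_children \<tau> u} \<inter> space M)"
    using ne T_iff by blast
  also have "prob \<dots> = (\<Prod>u\<in>\<tau>. prob (\<xi> u -` {num_children \<tau> u} \<inter> space M))"
    using ne assms(4) by (intro indep_varsD[OF ind]) auto
  also have "\<dots> = (\<Prod>u\<in>\<tau>. pmf \<mu> (num_children \<tau> u))"
  proof (rule prod.cong[OF refl])
    fix u
    have "prob (\<xi> u -` {num_children \<tau> u} \<inter> space M)
        = measure (distr M (count_space UNIV) (\<xi> u)) {num_children \<tau> u}"
      using rv by (simp add: measure_distr)
    then show "prob (\<xi> u -` {num_children \<tau> u} \<inter> space M) = pmf \<mu> (num_children \<tau> u)"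
      by (simp add: law pmf.rep_eq)
  qed
  finally show ?thesis .
qed

lemma BGW_tree_canonical:
  "BGW_tree (\<Pi>\<^sub>M u\<in>UNIV. measure_pmf \<mu>) \<mu> tree_of"
proof -
  let ?M = "\<Pi>\<^sub>M u\<in>(UNIV :: nat list set). measure_pmf \<mu>"
  interpret prob_space ?M by (rule prob_space_PiM) (rule prob_space_measure_pmf)
  have law: "distr ?M (count_space UNIV) (\<lambda>\<omega>. \<omega> u) = measure_pmf \<mu>" for u
  proof -
    have "distr ?M (count_space UNIV) (\<lambda>\<omega>. \<omega> u) = distr ?M (measure_pmf \<mu>) (\<lambda>\<omega>. \<omega> u)"
      by (rule distr_cong) auto
    then show ?thesis
      using distr_PiM_component[of UNIV "\<lambda>_. measure_pmf \<mu>" u]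
      by (simp add: prob_space_measure_pmf)
  qed
  have "indep_vars (\<lambda>_. count_space UNIV) (\<lambda>u \<omega>. \<omega> u) UNIV"
  proof (subst indep_vars_iff_distr_eq_PiM)
    show "distr ?M (\<Pi>\<^sub>M i\<in>UNIV. count_space UNIV) (\<lambda>x. \<lambda>i\<in>UNIV. x i)
      = (\<Pi>\<^sub>M i\<in>UNIV. distr ?M (count_space UNIV) (\<lambda>\<omega>. \<omega> i))"
      unfolding law restrict_UNIV
      by (rule distr_id2) (auto intro!: sets_PiM_cong)
  next
    fix u :: "nat list"
    have "(\<lambda>\<omega>. \<omega> u) \<in> measurable ?M (measure_pmf \<mu>)" by simp
    then show "(\<lambda>\<omega>. \<omega> u) \<in> measurable ?M (count_space UNIV)"
      by (simp cong: measurable_cong_sets)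
  qed auto
  with law show ?thesis
    unfolding BGW_tree_def by (intro exI[of _ "\<lambda>u \<omega>. \<omega> u"]) auto
qed

end

theory Submission
  imports Defs
begin

text \<open>
  Finite plane trees correspond, via Polish notation, to the words of outdegrees satisfying a
  ballot condition. By a weighted form of Kemperman's formula, this condition holds with the
  same probability \<open>1 / n\<close> for every multiset of letters, so it can be dropped: the multiset of
  outdegrees of the conditioned tree is that of a random word of length \<open>n\<close> with sum \<open>n - 1\<close>
  and \<open>k\<close> zeros, weighted by the product of the probabilities of its letters. For such words, a
  switching argument that trades one letter \<open>d + 2\<close> and \<open>d\<close> letters 1 for \<open>d + 1\<close> letters 2
  bounds the mean number of letters \<open>d + 2\<close> by \<open>C k (C' k / n)^d\<close>, so the letters above 2
  contribute \<open>o(k)\<close> in mean, and Markov's inequality concludes.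
\<close>

section \<open>Kemperman's formula\<close>

text \<open>Since \<open>length w - sum_list w\<close> is the height of the stack after reading
  \<open>w\<close>, the inequality says that the next letter \<open>x\<close> never pops more trees
  than the stack holds. Equivalently, every nonempty suffix has sum strictly below its length: a
  Lukasiewicz word, written for reading from the right.\<close>

primrec luk_word :: "nat list \<Rightarrow> bool" where
  "luk_word [] \<longleftrightarrow> True"
| "luk_word (x # w) \<longleftrightarrow> luk_word w \<and> x + sum_list w \<le> length w"

text \<open>These are the candidates for the outdegree word of a forest of \<open>r\<close> trees
  with \<open>n\<close> vertices. The additive form avoids truncated subtraction.\<close>

definition words :: "nat \<Rightarrow> nat \<Rightarrow> nat list set" where
  "words r n = {w. length w = n \<and> sum_list w + r = n}"

lemma finite_words: "finite (words r n)"
proof (rule finite_subset)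
  show "words r n \<subseteq> {w. set w \<subseteq> {..n} \<and> length w = n}"
    using member_le_sum_list by (fastforce simp: words_def)
qed (simp add: finite_lists_length_eq)

lemma sum_words_Suc:
  fixes f :: "nat list \<Rightarrow> real"
  assumes "r > 0"
  shows "(\<Sum>v\<in>words r (Suc n). f v) = (\<Sum>x\<le>n. \<Sum>w\<in>words (x + r - 1) n. f (x # w))"
proof -
  have "(\<Sum>x\<le>n. \<Sum>w\<in>words (x + r - 1) n. f (x # w))
      = (\<Sum>(x, w)\<in>(SIGMA x:{..n}. words (x + r - 1) n). f (x # w))"
    by (rule sum.Sigma) (auto simp: finite_words)
  also have "\<dots> = (\<Sum>v\<in>words r (Suc n). f v)"
    using assms
    by (intro sum.reindex_bij_witness[of _ "\<lambda>v. (hd v, tl v)" "\<lambda>(x, w). x # w"])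
       (auto simp: words_def length_Suc_conv)
  finally show ?thesis by simp
qed

text \<open>For \<open>r > 0\<close> the sum of a word in \<open>words r (Suc n)\<close> is at most
  \<open>n\<close>, so the condition that \<open>luk_word\<close> puts on the first letter is
  automatic and only the one on the tail remains.\<close>

lemma sum_luk_words_Suc:
  fixes f :: "nat list \<Rightarrow> real"
  assumes "r > 0"
  shows "(\<Sum>v | v \<in> words r (Suc n) \<and> luk_word v. f v)
    = (\<Sum>x\<le>n. \<Sum>w | w \<in> words (x + r - 1) n \<and> luk_word w. f (x # w))"
proof -
  have "(\<Sum>x\<le>n. \<Sum>w | w \<in> words (x + r - 1) n \<and> luk_word w. f (x # w))
      = (\<Sum>(x, w)\<in>(SIGMA x:{..n}. {w \<in> words (x + r - 1) n. luk_word w}). f (x # w))"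
    by (rule sum.Sigma) (auto simp: finite_words)
  also have "\<dots> = (\<Sum>v | v \<in> words r (Suc n) \<and> luk_word v. f v)"
    using assms
    by (intro sum.reindex_bij_witness[of _ "\<lambda>v. (hd v, tl v)" "\<lambda>(x, w). x # w"])
       (auto simp: words_def length_Suc_conv)
  finally show ?thesis by simp
qed

text \<open>Rotations preserve both \<open>words r n\<close> and the multiset of letters, so every
  position has the same weighted mean as the head, and the letters at all positions add up to
  \<open>n - r\<close>.\<close>

lemma sum_words_hd:
  fixes F :: "nat multiset \<Rightarrow> real"
  shows "real n * (\<Sum>v\<in>words r n. real (hd v) * F (mset v))
    = (real n - real r) * (\<Sum>v\<in>words r n. F (mset v))"
proof -
  have rot: "(\<Sum>v\<in>words r n. real (v ! j) * F (mset v))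
      = (\<Sum>v\<in>words r n. real (hd v) * F (mset v))" if "j < n" for j
  proof -
    have inv: "rotate (n - j) (rotate j v) = v" "rotate j (rotate (n - j) v) = v"
      if "length v = n" for v :: "nat list"
      using that \<open>j < n\<close> by (simp_all add: rotate_rotate)
    have mset_rotate: "mset (rotate i v) = mset v" for i and v :: "nat list"
    proof (induction i)
      case (Suc i)
      have "mset (rotate1 u) = mset u" for u :: "nat list"
        by (cases u) simp_all
      then show ?case using Suc by simp
    qed simp
    have mem: "rotate i v \<in> words r n" if "v \<in> words r n" for i v
      using that sum_mset_sum_list[of "rotate i v"] sum_mset_sum_list[of v]
      by (simp add: words_def mset_rotate del: sum_mset_sum_list)
    show ?thesis
    proof (rule sum.reindex_bij_witness[of _ "rotate (n - j)" "rotate j"])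
      fix v assume "v \<in> words r n"
      then show "rotate (n - j) (rotate j v) = v" "rotate j (rotate (n - j) v) = v"
        "real (hd (rotate j v)) * F (mset (rotate j v)) = real (v ! j) * F (mset v)"
        using inv \<open>j < n\<close> hd_rotate_conv_nth[of v j]
        by (cases "v = []"; auto simp: words_def mset_rotate)+
    qed (auto intro: mem)
  qed
  have "real n * (\<Sum>v\<in>words r n. real (hd v) * F (mset v))
      = (\<Sum>j<n. \<Sum>v\<in>words r n. real (v ! j) * F (mset v))"
    by (simp add: rot)
  also have "\<dots> = (\<Sum>v\<in>words r n. \<Sum>j<n. real (v ! j) * F (mset v))"
    by (rule sum.swap)
  also have "\<dots> = (\<Sum>v\<in>words r n. (real n - real r) * F (mset v))"
  proof (rule sum.cong[OF refl])
    fix v assume "v \<in> words r n"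
    then have "length v = n" "(\<Sum>j<n. real (v ! j)) = real n - real r"
      by (auto simp: words_def sum_list_sum_nth atLeast0LessThan simp flip: of_nat_sum)
    then show "(\<Sum>j<n. real (v ! j) * F (mset v)) = (real n - real r) * F (mset v)"
      by (simp flip: sum_distrib_right)
  qed
  finally show ?thesis by (simp add: sum_distrib_left)
qed

text \<open>
  Kemperman's formula, weighted. Peeling off the first letter \<open>x\<close> replaces \<open>r\<close> by
  \<open>x + r - 1\<close>, and on average over the rotations of a word \<open>x\<close> is \<open>(n - r) / n\<close>.
\<close>

lemma sum_luk_words:
  fixes F :: "nat multiset \<Rightarrow> real"
  shows "real n * (\<Sum>w | w \<in> words r n \<and> luk_word w. F (mset w))
    = real r * (\<Sum>w\<in>words r n. F (mset w))"
proof (induction n arbitrary: r F)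
  case 0
  then show ?case by (auto simp: words_def)
next
  case (Suc n)
  let ?L = "\<Sum>v | v \<in> words r (Suc n) \<and> luk_word v. F (mset v)"
  let ?R = "\<Sum>v\<in>words r (Suc n). F (mset v)"
  \<comment> \<open>Peeling off a letter requires \<open>r > 0\<close>, and the factor
    \<open>n\<close> brought in by the induction hypothesis can only be cancelled when
    \<open>n > 0\<close>.\<close>
  show ?case
  proof (cases "r = 0 \<or> n = 0")
    case True
    show ?thesis
    proof (cases "r = 0")
      case True
      have "\<not> luk_word w" if "w \<in> words 0 (Suc n)" for w
        using that by (cases w) (auto simp: words_def)
      then have "{w. w \<in> words r (Suc n) \<and> luk_word w} = {}"
        using True by blast
      then have "?L = 0" by (simp only: sum.empty)
      then show ?thesis by (subst \<open>?L = 0\<close>) (simp add: True)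
    next
      case False
      with \<open>r = 0 \<or> n = 0\<close> have "n = 0" by simp
      have "luk_word w \<and> r = 1" if "w \<in> words r (Suc 0)" for w
        using that \<open>r \<noteq> 0\<close> by (cases w) (auto simp: words_def)
      then have "{w. w \<in> words r (Suc n) \<and> luk_word w} = words r (Suc n)"
        "words r (Suc n) = {} \<or> r = 1"
        using \<open>n = 0\<close> by blast+
      then show ?thesis using \<open>n = 0\<close> by auto
    qed
  next
    case False
    then have "r > 0" "n > 0" by auto
    have "real n * ?L = (\<Sum>x\<le>n. real n *
        (\<Sum>w | w \<in> words (x + r - 1) n \<and> luk_word w. F (add_mset x (mset w))))"
      by (simp add: sum_luk_words_Suc[OF \<open>r > 0\<close>] sum_distrib_left)
    also have "\<dots> = (\<Sum>x\<le>n. \<Sum>w\<in>words (x + r - 1) n.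
        (real x + real r - 1) * F (add_mset x (mset w)))"
    proof (intro sum.cong refl)
      fix x
      show "real n * (\<Sum>w | w \<in> words (x + r - 1) n \<and> luk_word w. F (add_mset x (mset w)))
        = (\<Sum>w\<in>words (x + r - 1) n. (real x + real r - 1) * F (add_mset x (mset w)))"
        using Suc.IH[where r = "x + r - 1" and F = "\<lambda>A. F (add_mset x A)"] \<open>r > 0\<close>
        by (simp add: sum_distrib_left of_nat_diff)
    qed
    also have "\<dots> = (\<Sum>v\<in>words r (Suc n). (real (hd v) + real r - 1) * F (mset v))"
      by (simp add: sum_words_Suc[OF \<open>r > 0\<close>])
    also have "\<dots> = (\<Sum>v\<in>words r (Suc n). real (hd v) * F (mset v)) + (real r - 1) * ?R"
      by (simp add: algebra_simps sum.distrib sum_subtractf sum_distrib_left)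
    finally have "real (Suc n) * (real n * ?L)
        = real (Suc n) * (\<Sum>v\<in>words r (Suc n). real (hd v) * F (mset v))
          + real (Suc n) * (real r - 1) * ?R"
      by (simp only: distrib_left mult.assoc)
    \<comment> \<open>The coefficients add up:
      \<open>(Suc n - r) + Suc n * (r - 1) = n * r\<close>.\<close>
    also have "\<dots> = real n * (real r * ?R)"
      unfolding sum_words_hd by (simp add: algebra_simps)
    finally have "real n * (real (Suc n) * ?L) = real n * (real r * ?R)"
      by (simp add: mult.left_commute)
    then show ?thesis using \<open>n > 0\<close> by simp
  qed
qed

section \<open>Plane trees and words\<close>

definition graft :: "nat list set list \<Rightarrow> nat list set" where
  "graft ts = insert [] (\<Union>j<length ts. (#) j ` (ts ! j))"

lemma Nil_in_graft [simp]: "[] \<in> graft ts"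
  by (simp add: graft_def)

lemma Cons_in_graft [simp]: "j # u \<in> graft ts \<longleftrightarrow> j < length ts \<and> u \<in> ts ! j"
  by (auto simp: graft_def)

lemma Nil_in_plane_tree: "plane_tree t \<Longrightarrow> [] \<in> t"
  by (simp add: plane_tree_def)

lemma plane_tree_parent: "plane_tree t \<Longrightarrow> u @ [j] \<in> t \<Longrightarrow> u \<in> t"
  by (simp add: plane_tree_def)

lemma plane_tree_sibling: "plane_tree t \<Longrightarrow> u @ [j] \<in> t \<Longrightarrow> i < j \<Longrightarrow> u @ [i] \<in> t"
  by (simp add: plane_tree_def)

lemma finite_children: "plane_tree t \<Longrightarrow> u \<in> t \<Longrightarrow> finite {j. u @ [j] \<in> t}"
  by (simp add: plane_tree_def)

lemma children_root_graft:
  assumes "list_all plane_tree ts"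
  shows "{j. [j] \<in> graft ts} = {..<length ts}"
  using assms by (auto simp: list_all_length Nil_in_plane_tree)

lemma num_children_graft:
  assumes "list_all plane_tree ts"
  shows "num_children (graft ts) [] = length ts"
    and "j < length ts \<Longrightarrow> num_children (graft ts) (j # u) = num_children (ts ! j) u"
  using children_root_graft[OF assms] by (simp_all add: num_children_def)

text \<open>Each grafted plane tree contains the empty word and so shows up as a child of the root.
  The root degree thus gives the number of subtrees, and the first letters of the words separate
  them.\<close>

lemma graft_inject:
  assumes "list_all plane_tree ts" "list_all plane_tree us" "graft ts = graft us"
  shows "ts = us"
proof (rule nth_equalityI)
  show len: "length ts = length us"
    using num_children_graft(1)[OF assms(1)] num_children_graft(1)[OF assms(2)] assms(3) by simp
  show "ts ! j = us ! j" if "j < length ts" for j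
  proof (rule set_eqI)
    fix u
    show "u \<in> ts ! j \<longleftrightarrow> u \<in> us ! j"
      using Cons_in_graft[of j u ts] Cons_in_graft[of j u us] assms(3) that len by simp
  qed
qed

lemma plane_tree_graft:
  assumes "list_all plane_tree ts"
  shows "plane_tree (graft ts)"
  unfolding plane_tree_def
proof (intro conjI allI ballI impI)
  fix u j
  assume "u @ [j] \<in> graft ts"
  then show "u \<in> graft ts"
    using assms by (cases u) (auto simp: list_all_length intro: plane_tree_parent)
next
  fix u :: "nat list" and j i :: nat
  assume "u @ [j] \<in> graft ts" "i < j"
  then show "u @ [i] \<in> graft ts"
    using assms by (cases u) (auto simp: list_all_length Nil_in_plane_tree intro: plane_tree_sibling)
next
  fix u assume "u \<in> graft ts"
  then show "finite {j. u @ [j] \<in> graft ts}"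
    using assms children_root_graft[OF assms]
    by (cases u) (auto simp: list_all_length finite_children)
qed simp

lemma finite_graft_iff: "finite (graft ts) \<longleftrightarrow> list_all finite ts"
  by (auto simp: graft_def list_all_length finite_image_iff)

lemma plane_tree_subtree:
  assumes "plane_tree t" "j < num_children t []"
  shows "plane_tree {u. j # u \<in> t}"
proof -
  have "[j] \<in> t"
    using plane_tree_children[OF assms(1), of "[]" j] assms by (simp add: Nil_in_plane_tree)
  moreover have "(j # u) @ [i] \<in> t \<Longrightarrow> j # u \<in> t \<and> (\<forall>l<i. (j # u) @ [l] \<in> t)"
    and "j # u \<in> t \<Longrightarrow> finite {i. (j # u) @ [i] \<in> t}" for u i
    using assms(1) unfolding plane_tree_def by blast+
  ultimately show ?thesis
    unfolding plane_tree_def mem_Collect_eq append_Cons by blast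
qed

text \<open>By closure under prefixes, the first letter of any nonempty word of the tree is the rank
  of a child of the root.\<close>

lemma plane_tree_eq_graft:
  assumes "plane_tree t"
  shows "t = graft (map (\<lambda>j. {u. j # u \<in> t}) [0..<num_children t []])"
proof -
  have "j # u \<in> t \<Longrightarrow> j < num_children t []" for j u
  proof (induction u rule: rev_induct)
    case Nil
    then show ?case
      using plane_tree_children[OF assms, of "[]" j] assms by (simp add: Nil_in_plane_tree)
  next
    case (snoc i u)
    then show ?case
      using plane_tree_parent[OF assms, of "j # u" i] by simp
  qed
  then have "u \<in> t \<longleftrightarrow> u \<in> graft (map (\<lambda>j. {u. j # u \<in> t}) [0..<num_children t []])" for u
    using assms by (cases u) (auto simp: Nil_in_plane_tree)
  then show ?thesis by blast
qed

section \<open>Multisets of outdegrees\<close>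

definition degs :: "nat list set \<Rightarrow> nat multiset" where
  "degs t = image_mset (num_children t) (mset_set t)"

lemma size_degs: "size (degs t) = card t"
  by (simp add: degs_def)

lemma count_degs: "finite t \<Longrightarrow> count (degs t) i = \<phi> i t"
  by (auto simp: degs_def \<phi>_def count_image_mset_eq_card_vimage)

lemma mset_set_graft:
  assumes "list_all finite ts"
  shows "mset_set (graft ts)
    = add_mset [] (\<Sum>j<length ts. image_mset ((#) j) (mset_set (ts ! j)))"
proof -
  have *: "mset_set (\<Union>j<m. (#) j ` (ts ! j)) = (\<Sum>j<m. image_mset ((#) j) (mset_set (ts ! j)))"
    if "m \<le> length ts" for m
    using that
  proof (induction m)
    case (Suc m)
    have "mset_set (\<Union>j<Suc m. (#) j ` (ts ! j))
        = mset_set ((\<Union>j<m. (#) j ` (ts ! j)) \<union> (#) m ` (ts ! m))"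
      by (simp add: lessThan_Suc Un_commute)
    also have "\<dots> = mset_set (\<Union>j<m. (#) j ` (ts ! j)) + mset_set ((#) m ` (ts ! m))"
      using Suc.prems assms by (intro mset_set_Union) (auto simp: list_all_length)
    finally show ?case
      using Suc by (simp add: image_mset_mset_set)
  qed simp
  have "finite (\<Union>j<length ts. (#) j ` (ts ! j))"
    using assms by (auto simp: list_all_length)
  then have "mset_set (graft ts) = add_mset [] (mset_set (\<Union>j<length ts. (#) j ` (ts ! j)))"
    unfolding graft_def by (intro mset_set.insert) auto
  then show ?thesis by (simp add: *)
qed

text \<open>Prefixing a subtree by its rank leaves the outdegrees of its vertices unchanged; the
  root adds the letter \<open>length ts\<close>.\<close>

lemma degs_graft:
  assumes "list_all plane_tree ts" "list_all finite ts"
  shows "degs (graft ts) = add_mset (length ts) (sum_list (map degs ts))"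
proof -
  have "image_mset (num_children (graft ts)) (\<Sum>j<m. image_mset ((#) j) (mset_set (ts ! j)))
      = (\<Sum>j<m. degs (ts ! j))" if "m \<le> length ts" for m
    using that
  proof (induction m)
    case (Suc m)
    have "num_children (graft ts) \<circ> (#) m = num_children (ts ! m)"
      using Suc.prems num_children_graft(2)[OF assms(1)] by auto
    with Suc show ?case
      by (simp add: degs_def multiset.map_comp)
  qed simp
  then have "degs (graft ts) = add_mset (length ts) (\<Sum>j<length ts. degs (ts ! j))"
    unfolding degs_def[of "graft ts"]
    by (simp add: mset_set_graft[OF assms(2)] num_children_graft(1)[OF assms(1)])
  then show ?thesis
    by (simp add: sum_list_sum_nth atLeast0LessThan)
qed

text \<open>
  Reads a word from right to left as a program in Polish notation: the letter \<open>x\<close> pops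
  \<open>x\<close> trees from the stack and pushes the tree having them as subtrees of its root.
\<close>

primrec parse :: "nat list \<Rightarrow> nat list set list" where
  "parse [] = []"
| "parse (x # w) = graft (take x (parse w)) # drop x (parse w)"

lemma list_all_take_drop: "list_all P xs \<Longrightarrow> list_all P (take n xs) \<and> list_all P (drop n xs)"
  by (auto simp: list_all_iff dest: in_set_takeD in_set_dropD)

text \<open>\<open>take\<close> and \<open>drop\<close> tolerate a stack that is too short, so the
  result is a list of finite plane trees for every word, Lukasiewicz or not.\<close>

lemma parse_properties:
  "list_all plane_tree (parse w) \<and> list_all finite (parse w)"
  by (induction w) (auto simp: list_all_take_drop plane_tree_graft finite_graft_iff)

lemma length_parse: "luk_word w \<Longrightarrow> length (parse w) + sum_list w = length w"
  by (induction w) auto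

lemma degs_parse: "luk_word w \<Longrightarrow> sum_list (map degs (parse w)) = mset w"
proof (induction w)
  case (Cons x w)
  let ?s = "parse w"
  have x: "x \<le> length ?s"
    using Cons.prems length_parse[of w] by simp
  have "sum_list (map degs ?s) = sum_list (map degs (take x ?s @ drop x ?s))" by simp
  also have "\<dots> = sum_list (map degs (take x ?s)) + sum_list (map degs (drop x ?s))"
    unfolding map_append sum_list_append ..
  finally show ?case
    using Cons x parse_properties[of w] by (simp add: degs_graft list_all_take_drop)
qed simp

text \<open>Parsing can be undone letter by letter: the tree on top of the stack was pushed last,
  its root degree is the letter that was read, and its root subtrees put back on the rest give the
  previous stack.\<close>

lemma parse_inject:
  "luk_word v \<Longrightarrow> luk_word w \<Longrightarrow> parse v = parse w \<Longrightarrow> v = w"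
proof (induction v arbitrary: w)
  case Nil
  then show ?case by (cases w) auto
next
  case (Cons x v)
  from Cons.prems(3) obtain y w' where w: "w = y # w'" by (cases w) simp_all
  have le: "x \<le> length (parse v)" "y \<le> length (parse w')"
    using Cons.prems length_parse[of v] length_parse[of w'] by (auto simp: w)
  have take: "take x (parse v) = take y (parse w')"
    using Cons.prems parse_properties[of v] parse_properties[of w']
    by (intro graft_inject) (simp_all add: w list_all_take_drop)
  have drop: "drop x (parse v) = drop y (parse w')"
    using Cons.prems(3) unfolding w parse.simps list.inject by blast
  \<comment> \<open>The stacks are high enough for \<open>take\<close> to return exactly
    \<open>x\<close> and \<open>y\<close> trees; this is where \<open>luk_word\<close> is
    used.\<close>
  have "x = y"
    using arg_cong[OF take, of length] unfolding length_take min_absorb2[OF le(1)] min_absorb2[OF le(2)] .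
  have "parse v = take x (parse v) @ drop x (parse v)" by simp
  also have "\<dots> = take y (parse w') @ drop y (parse w')" by (simp only: take drop)
  also have "\<dots> = parse w'" by simp
  finally have "parse v = parse w'" .
  then have "v = w'"
    using Cons.prems by (intro Cons.IH) (simp_all add: w)
  with \<open>x = y\<close> show ?case by (simp add: w)
qed

lemma card_graft:
  assumes "list_all plane_tree ts" "list_all finite ts"
  shows "card (graft ts) = Suc (sum_list (map card ts))"
proof -
  have "size (sum_list (map degs ts)) = sum_list (map card ts)" for ts
    by (induction ts) (auto simp: size_degs)
  then show ?thesis
    using size_degs[of "graft ts"] by (simp add: degs_graft assms)
qed

text \<open>Opening the first tree, that is, replacing it by the subtrees of its root, removes one
  vertex in total. A word for the shorter forest, preceded by the root degree, parses to the
  original one.\<close>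

lemma parse_surj:
  assumes "list_all plane_tree ts" "list_all finite ts"
  shows "\<exists>w. luk_word w \<and> parse w = ts"
  using assms
proof (induction "sum_list (map card ts)" arbitrary: ts rule: less_induct)
  case less
  show ?case
  proof (cases ts)
    case Nil
    then show ?thesis by (intro exI[of _ "[]"]) simp
  next
    case (Cons t ts')
    define us where "us = map (\<lambda>j. {u. j # u \<in> t}) [0..<num_children t []]"
    have t: "plane_tree t" "finite t" and ts': "list_all plane_tree ts'" "list_all finite ts'"
      using less.prems by (auto simp: Cons)
    have t_eq: "t = graft us"
      using plane_tree_eq_graft[OF t(1)] by (simp add: us_def)
    have us: "list_all plane_tree us" "list_all finite us"
      using plane_tree_subtree[OF t(1)] t(2)[unfolded t_eq finite_graft_iff]
      by (auto simp: us_def list_all_length)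
    have "sum_list (map card (us @ ts')) < sum_list (map card ts)"
      using card_graft[OF us] by (simp add: Cons t_eq)
    then obtain w where w: "luk_word w" "parse w = us @ ts'"
      using less.hyps[of "us @ ts'"] us ts' by auto
    then have "luk_word (length us # w)"
      using length_parse[of w] by simp
    moreover have "parse (length us # w) = ts"
      by (simp add: w Cons t_eq)
    ultimately show ?thesis by blast
  qed
qed

lemma parse_singleton:
  assumes "w \<in> words 1 n" "luk_word w"
  obtains t where "parse w = [t]" "plane_tree t" "finite t" "degs t = mset w" "card t = n"
proof -
  have "length (parse w) = 1"
    using assms length_parse[of w] by (simp add: words_def)
  then obtain t where t: "parse w = [t]"
    by (cases "parse w") auto
  moreover from t have "degs t = mset w"
    using degs_parse[OF assms(2)] by simp
  moreover from this have "card t = n"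
    using size_degs[of t] assms(1) by (simp add: words_def)
  ultimately show thesis
    using parse_properties[of w] that by simp
qed

lemma bij_betw_parse:
  "bij_betw (\<lambda>w. hd (parse w)) {w \<in> words 1 n. luk_word w}
     {t. plane_tree t \<and> finite t \<and> card t = n}"
proof -
  show ?thesis
    unfolding bij_betw_def
  proof (intro conjI inj_onI set_eqI iffI)
    fix v w
    assume v: "v \<in> {w \<in> words 1 n. luk_word w}" and w: "w \<in> {w \<in> words 1 n. luk_word w}"
      and eq: "hd (parse v) = hd (parse w)"
    obtain t where t: "parse v = [t]" using v by (blast elim: parse_singleton)
    obtain u where u: "parse w = [u]" using w by (blast elim: parse_singleton)
    show "v = w"
      using v w eq t u by (intro parse_inject) simp_all
  next
    fix t assume "t \<in> (\<lambda>w. hd (parse w)) ` {w \<in> words 1 n. luk_word w}"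
    then show "t \<in> {t. plane_tree t \<and> finite t \<and> card t = n}"
      by (auto elim: parse_singleton[simplified])
  next
    fix t assume "t \<in> {t. plane_tree t \<and> finite t \<and> card t = n}"
    then have t: "plane_tree t" "finite t" "card t = n" by auto
    obtain w where w: "luk_word w" "parse w = [t]"
      using parse_surj[of "[t]"] t by auto
    have "mset w = degs t"
      using degs_parse[OF w(1)] w(2) by simp
    then have "length w = n"
      using size_degs[of t] t(3) size_mset[of w] by simp
    then have "w \<in> words 1 n"
      using length_parse[OF w(1)] w(2) by (simp add: words_def)
    then show "t \<in> (\<lambda>w. hd (parse w)) ` {w \<in> words 1 n. luk_word w}"
      using w by (intro image_eqI[of _ _ w]) auto
  qed
qed

section \<open>The law of the outdegree multiset of the random tree\<close>

text \<open>The probability of a tree depends only on its outdegree multiset, so the sum over trees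
  becomes a sum over Lukasiewicz words of a function of \<open>mset w\<close>, to which the weighted
  Kemperman formula applies.\<close>

lemma prob_degs:
  fixes M :: "'w measure" and B :: "nat multiset \<Rightarrow> bool"
  assumes "prob_space M" "BGW_tree M \<mu> T" "n > 0"
  shows "\<P>(\<omega> in M. finite (T \<omega>) \<and> card (T \<omega>) = n \<and> B (degs (T \<omega>)))
    = (\<Sum>w | w \<in> words 1 n \<and> B (mset w). prod_list (map (pmf \<mu>) w)) / real n"
proof -
  interpret prob_space M by fact
  obtain \<xi> :: "nat list \<Rightarrow> 'w \<Rightarrow> nat" where
    ind: "indep_vars (\<lambda>_. count_space UNIV) \<xi> UNIV" and
    T: "\<And>\<omega>. \<omega> \<in> space M \<Longrightarrow> T \<omega> = tree_of (\<lambda>u. \<xi> u \<omega>)"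
    using assms(2) unfolding BGW_tree_def by blast
  have rv [measurable]: "\<xi> u \<in> measurable M (count_space UNIV)" for u
    using ind by (simp add: indep_vars_def)
  let ?A = "{t. plane_tree t \<and> finite t \<and> card t = n}"
  let ?L = "{w \<in> words 1 n. luk_word w}"
  \<comment> \<open>The restriction to \<open>B\<close> is put into the weight, so that the sum runs
    over all Lukasiewicz words.\<close>
  let ?f = "\<lambda>A. if B A then prod_mset (image_mset (pmf \<mu>) A) else 0"
  \<comment> \<open>Measurability of \<open>T\<close> is not part of \<open>BGW_tree\<close>, but
    \<open>T \<omega> = t\<close> for a finite \<open>t\<close> only involves the finitely many
    variables \<open>\<xi> u\<close> with \<open>u\<close> in \<open>t\<close>.\<close>
  have meas: "{\<omega> \<in> space M. T \<omega> = t} \<in> events" if "t \<in> ?A" for t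
  proof -
    have "T \<omega> = t \<longleftrightarrow> (\<forall>u\<in>t. \<xi> u \<omega> = num_children t u)" if "\<omega> \<in> space M" for \<omega>
      using T[OF that] tree_of_eq_iff[of t] \<open>t \<in> ?A\<close> by simp
    then have "{\<omega> \<in> space M. T \<omega> = t} = {\<omega> \<in> space M. \<forall>u\<in>t. \<xi> u \<omega> = num_children t u}"
      by blast
    also have "\<dots> \<in> events"
      using that by (auto intro!: sets.sets_Collect_finite_All)
    finally show ?thesis .
  qed
  have fin: "finite ?A"
    using bij_betw_finite[OF bij_betw_parse[of n]] finite_words[of 1 n] by simp
  have "{\<omega> \<in> space M. finite (T \<omega>) \<and> card (T \<omega>) = n \<and> B (degs (T \<omega>))}
      = (\<Union>t\<in>{t \<in> ?A. B (degs t)}. {\<omega> \<in> space M. T \<omega> = t})"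
    using T plane_tree_tree_of by auto
  also have "prob \<dots> = (\<Sum>t\<in>{t \<in> ?A. B (degs t)}. prob {\<omega> \<in> space M. T \<omega> = t})"
    using fin meas
    by (intro finite_measure_finite_Union)
       (auto simp: disjoint_family_on_def elim: rev_finite_subset)
  also have "\<dots> = (\<Sum>t\<in>?A. if B (degs t) then prob {\<omega> \<in> space M. T \<omega> = t} else 0)"
    using fin by (rule sum.inter_filter)
  also have "\<dots> = (\<Sum>t\<in>?A. ?f (degs t))"
    by (intro sum.cong refl if_cong)
       (auto simp: prob_BGW_tree_eq[OF assms(1,2)] degs_def multiset.map_comp comp_def
         prod_unfold_prod_mset)
  also have "\<dots> = (\<Sum>w\<in>?L. ?f (degs (hd (parse w))))"
    by (rule sum.reindex_bij_betw[OF bij_betw_parse, symmetric])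
  also have "\<dots> = (\<Sum>w\<in>?L. ?f (mset w))"
    by (intro sum.cong refl) (auto elim: parse_singleton[simplified])
  \<comment> \<open>Kemperman's formula with \<open>r = 1\<close> drops the ballot condition at the
    price of the factor \<open>1 / n\<close>.\<close>
  also have "\<dots> = (\<Sum>w\<in>words 1 n. ?f (mset w)) / real n"
    using sum_luk_words[where n = n and r = 1 and F = ?f] \<open>n > 0\<close> by (simp add: field_simps)
  also have "(\<Sum>w\<in>words 1 n. ?f (mset w))
      = (\<Sum>w | w \<in> words 1 n \<and> B (mset w). prod_list (map (pmf \<mu>) w))"
    using finite_words by (simp add: sum.inter_filter flip: prod_mset_prod_list)
  finally show ?thesis .
qed

section \<open>The switching argument\<close>

lemma prod_list_eq_prod_nth:
  fixes f :: "'a \<Rightarrow> 'b :: comm_monoid_mult"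
  shows "prod_list (map f w) = (\<Prod>j<length w. f (w ! j))"
  by (induction w) (simp_all add: prod.lessThan_Suc_shift del: prod.lessThan_Suc)

lemma count_list_eq_card: "count_list w x = card {j. j < length w \<and> w ! j = x}"
  by (simp add: count_list_eq_length_filter length_filter_conv_card eq_commute)

text \<open>With denominators cleared, this says that \<open>(k choose d) / k ^ d\<close> grows with
  \<open>k\<close>. It holds factor by factor: \<open>(k - i) * m \<le> (m - i) * k\<close>.\<close>

lemma choose_power_le:
  fixes k m d :: nat
  assumes "k \<le> m" "d \<le> m"
  shows "(k choose d) * m ^ d \<le> (m choose d) * k ^ d"
proof (cases "d \<le> k")
  case True
  have "(\<Prod>i<d. (real k - real i) * real m) \<le> (\<Prod>i<d. (real m - real i) * real k)"
  proof (rule prod_mono)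
    fix i assume "i \<in> {..<d}"
    then have "real i * real k \<le> real i * real m"
      using assms by (intro mult_left_mono) auto
    moreover have "real i * real m \<le> real k * real m"
      using \<open>i \<in> {..<d}\<close> True by (intro mult_right_mono) auto
    ultimately show "0 \<le> (real k - real i) * real m \<and>
        (real k - real i) * real m \<le> (real m - real i) * real k"
      by (auto simp: algebra_simps)
  qed
  then have "real (k choose d) * real m ^ d \<le> real (m choose d) * real k ^ d"
    by (simp add: binomial_gbinomial gbinomial_prod_rev prod.distrib atLeast0LessThan
        divide_right_mono)
  then show ?thesis
    by (simp only: flip: of_nat_power of_nat_mult of_nat_le_iff[where 'a = real])
qed (simp add: binomial_eq_0)

section \<open>Words with a prescribed number of zeros and their letter counts\<close>

context
  fixes \<mu> :: "nat pmf" and n k :: nat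
begin

definition leaf_words :: "nat list set" where
  "leaf_words = {w \<in> words 1 n. count_list w 0 = k}"

definition weight :: "nat list \<Rightarrow> real" where
  "weight w = prod_list (map (pmf \<mu>) w)"

text \<open>
  As \<open>n - 1\<close> is the sum of the letters, the word has \<open>k - 1 - excess\<close> letters 2: the
  excess measures how far the word is from using the letters 0, 1, 2 only.
\<close>

definition excess :: "nat list \<Rightarrow> nat" where
  "excess w = (\<Sum>i=3..n. (i - 1) * count_list w i)"

lemma finite_leaf_words: "finite leaf_words"
  by (simp add: leaf_words_def finite_words)

lemma weight_nonneg: "0 \<le> weight w"
  by (auto simp: weight_def intro!: prod_list_nonneg)

text \<open>Counting letters gives the second identity. Subtracting it from the sum of the letters,
  \<open>n - 1\<close>, gives the first: a letter \<open>i\<close> contributes \<open>i - 1\<close>,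
  which is \<open>-1\<close> for a zero, 0 for a 1 and 1 for a 2.\<close>

lemma leaf_words_counts:
  assumes "w \<in> leaf_words" "n \<ge> 2"
  shows "count_list w 2 + excess w + 1 = k"
    and "count_list w 1 + count_list w 2 + (\<Sum>i=3..n. count_list w i) + k = n"
proof -
  have w: "length w = n" "sum_list w + 1 = n" "count_list w 0 = k"
    using assms by (auto simp: leaf_words_def words_def)
  have sub: "set w \<subseteq> {..n}"
    using w member_le_sum_list by fastforce
  have split: "{..n} = {0, 1, 2} \<union> {3..n}"
    using assms(2) by auto
  have expand: "sum f {..n} = f 0 + f 1 + f 2 + (\<Sum>i=3..n. f i)" for f :: "nat \<Rightarrow> nat"
    unfolding split by (subst sum.union_disjoint) auto
  have "sum_list w = (\<Sum>i\<le>n. count_list w i * i)"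
    using sum_list_map_eq_sum_count2[OF sub, of "\<lambda>i. i"] by simp
  then have s: "sum_list w = count_list w 1 + 2 * count_list w 2 + (\<Sum>i=3..n. count_list w i * i)"
    by (simp add: expand)
  have "length w = (\<Sum>i\<le>n. count_list w i)"
    using sum_list_map_eq_sum_count2[OF sub, of "\<lambda>_. 1"] by (simp add: sum_list_triv)
  then have l: "n = k + count_list w 1 + count_list w 2 + (\<Sum>i=3..n. count_list w i)"
    using w by (simp add: expand)
  have "(\<Sum>i=3..n. count_list w i * i) = excess w + (\<Sum>i=3..n. count_list w i)"
    unfolding excess_def sum.distrib[symmetric]
    by (intro sum.cong) (auto simp: algebra_simps nat_diff_split)
  with s l w show "count_list w 2 + excess w + 1 = k"
    "count_list w 1 + count_list w 2 + (\<Sum>i=3..n. count_list w i) + k = n"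
    by linarith+
qed

lemma count_sum_le_excess: "(\<Sum>i=3..n. count_list w i) \<le> excess w"
  unfolding excess_def by (intro sum_mono) auto

section \<open>Marked words and the switching map\<close>

text \<open>Domain and target of the switching, as \<open>marked (d + 2) 1 d\<close> and
  \<open>marked 2 2 d\<close>. In the target \<open>p\<close> may lie in \<open>Q\<close>; this
  overcount is harmless, as the target only serves for an upper bound.\<close>

definition marked :: "nat \<Rightarrow> nat \<Rightarrow> nat \<Rightarrow> (nat list \<times> nat \<times> nat set) set" where
  "marked a b d = (SIGMA w:leaf_words. {p. p < n \<and> w ! p = a}
     \<times> {Q. Q \<subseteq> {j. j < n \<and> w ! j = b} \<and> card Q = d})"

lemma sum_marked:
  "(\<Sum>(w, _)\<in>marked a b d. weight w)
    = (\<Sum>w\<in>leaf_words. weight w * real (count_list w a * (count_list w b choose d)))"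
proof -
  have "(\<Sum>(w, _)\<in>marked a b d. weight w)
      = (\<Sum>w\<in>leaf_words. \<Sum>_\<in>{p. p < n \<and> w ! p = a}
         \<times> {Q. Q \<subseteq> {j. j < n \<and> w ! j = b} \<and> card Q = d}. weight w)"
    unfolding marked_def
    by (rule sum.Sigma[symmetric]) (auto simp: finite_leaf_words intro!: finite_cartesian_product)
  also have "\<dots> = (\<Sum>w\<in>leaf_words. weight w * real (count_list w a * (count_list w b choose d)))"
    by (intro sum.cong refl)
       (auto simp: count_list_eq_card n_subsets leaf_words_def words_def card_cartesian_product)
  finally show ?thesis .
qed

text \<open>
  Replacing one letter \<open>d + 2\<close> and \<open>d\<close> letters 1 by \<open>d + 1\<close> letters 2 preserves the sum, the
  length and the number of zeros. There are at least \<open>n - 2 * k\<close> letters 1 to choose from,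
  but at most \<open>k\<close> letters 2 to switch back: each of the \<open>d\<close> choices gains a factor \<open>k / n\<close>.
\<close>

definition switch :: "nat list \<times> nat \<times> nat set \<Rightarrow> nat list \<times> nat \<times> nat set" where
  "switch = (\<lambda>(w, p, Q). (map (\<lambda>j. if j \<in> insert p Q then 2 else w ! j) [0..<n], p, Q))"

context
  fixes d :: nat
  assumes d: "d \<ge> 1"
begin

text \<open>The marks are kept, and they tell where the letter \<open>d + 2\<close> and the letters
  1 stood; all other letters are untouched.\<close>

lemma inj_on_switch: "inj_on switch (marked (d + 2) 1 d)"
proof (rule inj_onI)
  fix x y assume xy: "x \<in> marked (d + 2) 1 d" "y \<in> marked (d + 2) 1 d" "switch x = switch y"
  obtain v p Q where x: "x = (v, p, Q)" by (cases x)
  obtain w where y: "y = (w, p, Q)" using xy(3) by (cases y) (auto simp: x switch_def)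
  have "v = w"
  proof (rule nth_equalityI)
    show "length v = length w"
      using xy by (auto simp: x y marked_def leaf_words_def words_def)
    fix j assume "j < length v"
    then have j: "j < n" using xy by (auto simp: x marked_def leaf_words_def words_def)
    have "map (\<lambda>j. if j \<in> insert p Q then 2 else v ! j) [0..<n] ! j
        = map (\<lambda>j. if j \<in> insert p Q then 2 else w ! j) [0..<n] ! j"
      using arg_cong[OF xy(3), of "\<lambda>z. fst z ! j"]
      unfolding x y switch_def case_prod_conv fst_conv .
    with j show "v ! j = w ! j"
      using xy(1,2) by (cases "j \<in> insert p Q") (auto simp: x y marked_def subset_iff)
  qed
  then show "x = y" by (simp add: x y)
qed

text \<open>Splitting the positions into \<open>p\<close>, \<open>Q\<close> and the rest isolates
  the change: the sum is kept since \<open>(d + 2) + d = 2 * (d + 1)\<close>, and no replaced letter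
  is zero.\<close>

lemma switch_marked:
  assumes "(w, p, Q) \<in> marked (d + 2) 1 d" "switch (w, p, Q) = (v, p', Q')"
  shows "(v, p', Q') \<in> marked 2 2 d"
    and "weight w * pmf \<mu> 2 ^ (d + 1) = weight v * (pmf \<mu> (d + 2) * pmf \<mu> 1 ^ d)"
proof -
  have w: "length w = n" "sum_list w + 1 = n" "count_list w 0 = k"
    and p: "p < n" "w ! p = d + 2" and Q: "Q \<subseteq> {j. j < n \<and> w ! j = 1}" "card Q = d"
    using assms(1) by (auto simp: marked_def leaf_words_def words_def)
  have v: "v = map (\<lambda>j. if j \<in> insert p Q then 2 else w ! j) [0..<n]" "p' = p" "Q' = Q"
    using assms(2) by (auto simp: switch_def)
  have vj: "v ! j = (if j \<in> insert p Q then 2 else w ! j)" if "j < n" for j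
    using that by (simp add: v)
  have len: "length v = n" by (simp add: v)
  have pQ: "p \<notin> Q" "finite Q" "insert p Q \<subseteq> {..<n}"
    using p Q d finite_subset[OF Q(1)] by auto
  have split: "{..<n} = ({..<n} - insert p Q) \<union> insert p Q"
    using pQ by auto
  have wQ: "w ! j = 1" if "j \<in> Q" for j using that Q by auto
  have sum: "sum_list u = sum ((!) u) ({..<n} - insert p Q) + (u ! p + sum ((!) u) Q)"
    if "length u = n" for u
    unfolding sum_list_sum_nth atLeast0LessThan that
    using pQ by (subst split, subst sum.union_disjoint) auto
  have prod: "weight u = (\<Prod>j\<in>{..<n} - insert p Q. pmf \<mu> (u ! j))
      * (pmf \<mu> (u ! p) * (\<Prod>j\<in>Q. pmf \<mu> (u ! j)))"
    if "length u = n" for u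
    unfolding weight_def prod_list_eq_prod_nth that
    using pQ by (subst split, subst prod.union_disjoint) auto
  have rest: "v ! j = w ! j" if "j \<in> {..<n} - insert p Q" for j
    using that vj by auto
  have vp: "v ! p = 2" and vQ: "\<And>j. j \<in> Q \<Longrightarrow> v ! j = 2"
    using vj p pQ by auto
  have "sum_list v = sum_list w"
    unfolding sum[OF len] sum[OF w(1)]
    using vp vQ p wQ Q(2) rest by simp
  moreover have "v ! j = 0 \<longleftrightarrow> w ! j = 0" if "j < n" for j
    using vj[OF that] p wQ[of j] by (cases "j \<in> insert p Q") auto
  then have "{j. j < n \<and> v ! j = 0} = {j. j < n \<and> w ! j = 0}" by blast
  ultimately have "v \<in> leaf_words"
    using w len by (simp add: leaf_words_def words_def count_list_eq_card)
  then show "(v, p', Q') \<in> marked 2 2 d"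
    using vp vQ p Q pQ by (auto simp: marked_def v(2,3))
  show "weight w * pmf \<mu> 2 ^ (d + 1) = weight v * (pmf \<mu> (d + 2) * pmf \<mu> 1 ^ d)"
    unfolding prod[OF len] prod[OF w(1)]
    using vp vQ p wQ Q(2) rest by (simp add: algebra_simps)
qed

lemma sum_marked_le:
  "pmf \<mu> 2 ^ (d + 1) * (\<Sum>(w, _)\<in>marked (d + 2) 1 d. weight w)
    \<le> pmf \<mu> 1 ^ d * (\<Sum>(w, _)\<in>marked 2 2 d. weight w)"
proof -
  have fin: "finite (marked 2 2 d)"
    by (auto simp: marked_def finite_leaf_words intro!: finite_SigmaI)
  have sub: "switch ` marked (d + 2) 1 d \<subseteq> marked 2 2 d"
    using switch_marked(1) by (fastforce simp: switch_def)
  have "pmf \<mu> 2 ^ (d + 1) * (\<Sum>(w, _)\<in>marked (d + 2) 1 d. weight w)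
      = (\<Sum>x\<in>marked (d + 2) 1 d. pmf \<mu> (d + 2) * pmf \<mu> 1 ^ d * weight (fst (switch x)))"
    unfolding sum_distrib_left
  proof (intro sum.cong refl)
    fix x assume x: "x \<in> marked (d + 2) 1 d"
    obtain w p Q where x_eq: "x = (w, p, Q)" by (cases x)
    obtain v p' Q' where s: "switch (w, p, Q) = (v, p', Q')" by (cases "switch (w, p, Q)")
    show "pmf \<mu> 2 ^ (d + 1) * (case x of (w, _) \<Rightarrow> weight w)
        = pmf \<mu> (d + 2) * pmf \<mu> 1 ^ d * weight (fst (switch x))"
      using switch_marked(2)[OF _ s] x by (simp add: x_eq s mult.commute)
  qed
  also have "\<dots> = pmf \<mu> (d + 2) * pmf \<mu> 1 ^ d
      * (\<Sum>y\<in>switch ` marked (d + 2) 1 d. weight (fst y))"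
    unfolding sum.reindex[OF inj_on_switch] sum_distrib_left comp_def ..
  also have "\<dots> \<le> pmf \<mu> (d + 2) * pmf \<mu> 1 ^ d * (\<Sum>y\<in>marked 2 2 d. weight (fst y))"
    by (intro mult_left_mono sum_mono2 fin sub) (auto simp: weight_nonneg)
  \<comment> \<open>The bound \<open>pmf \<mu> (d + 2) \<le> 1\<close> makes the estimate uniform
    over all offspring laws with given \<open>pmf \<mu> 1\<close> and
    \<open>pmf \<mu> 2\<close>.\<close>
  also have "\<dots> \<le> 1 * pmf \<mu> 1 ^ d * (\<Sum>y\<in>marked 2 2 d. weight (fst y))"
    by (intro mult_right_mono) (auto simp: weight_nonneg pmf_le_1 intro!: sum_nonneg)
  finally show ?thesis by (simp add: case_prod_unfold)
qed

end

section \<open>Mean and tail of the excess\<close>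

abbreviation total :: real where
  "total \<equiv> \<Sum>w\<in>leaf_words. weight w"

text \<open>The factor gained for each letter 1 traded for a letter 2: the quotient of their
  probabilities times the bound \<open>k\<close> on the letters 2 over the bound
  \<open>n - 2 * k\<close> on the letters 1.\<close>

definition ratio :: real where
  "ratio = pmf \<mu> 1 / pmf \<mu> 2 * (real k / (real n - 2 * real k))"

context
  assumes kn: "3 * k \<le> n" "0 < k"
    and pos: "pmf \<mu> 0 > 0" "pmf \<mu> 1 > 0" "pmf \<mu> 2 > 0"
begin

text \<open>Both sides of \<open>sum_marked_le\<close> are estimated: at least
  \<open>m = n - 2 * k\<close> letters 1 are available for the forward switch and at most
  \<open>k\<close> letters 2 for the way back. Then \<open>choose_power_le\<close> turns the
  quotient of binomials into \<open>(k / m) ^ d\<close>.\<close>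

lemma count_mean_le:
  assumes "d \<ge> 1"
  shows "(\<Sum>w\<in>leaf_words. weight w * real (count_list w (d + 2)))
    \<le> real k / pmf \<mu> 2 * ratio ^ d * total"
proof (cases "d \<le> k")
  \<comment> \<open>A single letter \<open>d + 2\<close> has excess \<open>d + 1\<close>, whereas
    the total excess is below \<open>k\<close>; for \<open>d > k\<close> no such letter
    occurs.\<close>
  case False
  have "count_list w (d + 2) = 0" if "w \<in> leaf_words" for w
  proof (rule ccontr)
    assume nz: "count_list w (d + 2) \<noteq> 0"
    have "d + 2 \<le> n"
      using nz that member_le_sum_list[of "d + 2" w]
      by (auto simp: leaf_words_def words_def count_list_0_iff)
    then have "(d + 2 - 1) * count_list w (d + 2) \<le> excess w"
      unfolding excess_def using assms
      by (intro member_le_sum[where f = "\<lambda>i. (i - 1) * count_list w i"]) auto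
    moreover have "excess w < k"
      using leaf_words_counts(1)[OF that] kn by linarith
    moreover have "d + 2 - 1 \<le> (d + 2 - 1) * count_list w (d + 2)"
      using not0_implies_Suc[OF nz] by auto
    ultimately show False using False by linarith
  qed
  moreover have "0 \<le> real k / pmf \<mu> 2 * ratio ^ d * total"
    using kn pos by (auto simp: ratio_def weight_nonneg intro!: mult_nonneg_nonneg sum_nonneg
        zero_le_power divide_nonneg_nonneg)
  ultimately show ?thesis by simp
next
  case True
  define m where "m = n - 2 * k"
  \<comment> \<open>The assumption \<open>3 * k \<le> n\<close> gives \<open>k \<le> m\<close>, as
    \<open>choose_power_le\<close> requires.\<close>
  have m: "k \<le> m" "d \<le> m" "m > 0" using True kn by (auto simp: m_def)
  let ?E = "\<Sum>w\<in>leaf_words. weight w * real (count_list w (d + 2))"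
  have counts: "count_list w 2 \<le> k" "m \<le> count_list w 1" if "w \<in> leaf_words" for w
    using leaf_words_counts[OF that] count_sum_le_excess[of w] kn by (auto simp: m_def)
  have "real (m choose d) * ?E
      \<le> (\<Sum>w\<in>leaf_words. weight w * real (count_list w (d + 2) * (count_list w 1 choose d)))"
    unfolding sum_distrib_left
  proof (rule sum_mono)
    fix w assume "w \<in> leaf_words"
    have "count_list w (d + 2) * (m choose d)
        \<le> count_list w (d + 2) * (count_list w 1 choose d)"
      using counts(2)[OF \<open>w \<in> leaf_words\<close>] by (intro mult_left_mono binomial_right_mono) auto
    then have "weight w * real (count_list w (d + 2) * (m choose d))
        \<le> weight w * real (count_list w (d + 2) * (count_list w 1 choose d))"
      by (intro mult_left_mono weight_nonneg) linarith
    then show "real (m choose d) * (weight w * real (count_list w (d + 2)))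
        \<le> weight w * real (count_list w (d + 2) * (count_list w 1 choose d))"
      by (simp add: algebra_simps)
  qed
  then have "pmf \<mu> 2 ^ (d + 1) * (real (m choose d) * ?E)
      \<le> pmf \<mu> 2 ^ (d + 1) * (\<Sum>(w, _)\<in>marked (d + 2) 1 d. weight w)"
    unfolding sum_marked by (intro mult_left_mono) auto
  also have "\<dots> \<le> pmf \<mu> 1 ^ d * (\<Sum>(w, _)\<in>marked 2 2 d. weight w)"
    by (rule sum_marked_le[OF assms])
  also have "\<dots> \<le> pmf \<mu> 1 ^ d * (\<Sum>w\<in>leaf_words. weight w * real (k * (k choose d)))"
    unfolding sum_marked
    using counts(1)
    by (intro mult_left_mono sum_mono of_nat_mono mult_le_mono binomial_right_mono) (auto simp: weight_nonneg)
  finally have *: "pmf \<mu> 2 ^ (d + 1) * (real (m choose d) * ?E)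
      \<le> pmf \<mu> 1 ^ d * (real k * real (k choose d) * total)"
    by (simp add: sum_distrib_left mult_ac)
  have total: "total \<ge> 0" by (simp add: sum_nonneg weight_nonneg)
  have ch: "real (k choose d) * real m ^ d \<le> real (m choose d) * real k ^ d"
    using choose_power_le[OF m(1,2)] by (metis of_nat_le_iff of_nat_mult of_nat_power)
  have "real (m choose d) * (pmf \<mu> 2 ^ (d + 1) * real m ^ d * ?E)
      = real m ^ d * (pmf \<mu> 2 ^ (d + 1) * (real (m choose d) * ?E))"
    by (simp only: mult_ac)
  also have "\<dots> \<le> real m ^ d * (pmf \<mu> 1 ^ d * (real k * real (k choose d) * total))"
    by (intro mult_left_mono *) simp
  also have "\<dots> = (real (k choose d) * real m ^ d) * (pmf \<mu> 1 ^ d * real k * total)"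
    by (simp only: mult_ac)
  also have "\<dots> \<le> (real (m choose d) * real k ^ d) * (pmf \<mu> 1 ^ d * real k * total)"
    using total by (intro mult_right_mono ch) auto
  finally have "real (m choose d) * (pmf \<mu> 2 ^ (d + 1) * real m ^ d * ?E)
      \<le> real (m choose d) * (real k ^ d * pmf \<mu> 1 ^ d * real k * total)"
    by (simp only: mult_ac)
  then have "pmf \<mu> 2 ^ (d + 1) * real m ^ d * ?E \<le> real k ^ d * pmf \<mu> 1 ^ d * real k * total"
    using m(2) by (simp add: zero_less_binomial_iff)
  then have "?E \<le> real k ^ d * pmf \<mu> 1 ^ d * real k * total / (pmf \<mu> 2 ^ (d + 1) * real m ^ d)"
    using pos m(3) by (simp add: pos_le_divide_eq mult.commute)
  also have "\<dots> = real k / pmf \<mu> 2 * ratio ^ d * total"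
    using kn by (simp add: ratio_def m_def of_nat_diff power_mult_distrib power_divide mult_ac)
  finally show ?thesis .
qed

lemma excess_mean_le:
  assumes "ratio \<le> 1 / 4"
  shows "(\<Sum>w\<in>leaf_words. weight w * real (excess w)) \<le> 4 * ratio / pmf \<mu> 2 * real k * total"
proof -
  have r0: "ratio \<ge> 0" using kn by (simp add: ratio_def)
  have total: "total \<ge> 0" by (simp add: sum_nonneg weight_nonneg)
  have geom: "(\<Sum>d=1..N. real (d + 1) * ratio ^ d) \<le> 4 * ratio" for N
  proof -
    \<comment> \<open>This absorbs the linear factor into a geometric series of ratio
      \<open>2 * ratio \<le> 1 / 2\<close>, whose sum is at most 2.\<close>
    have "real (d + 1) \<le> 2 ^ d" for d
      by (induction d) auto
    then have "(\<Sum>d=1..N. real (d + 1) * ratio ^ d) \<le> (\<Sum>d=1..N. 2 ^ d * ratio ^ d)"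
      using r0 by (intro sum_mono mult_right_mono) auto
    also have "\<dots> = (\<Sum>d=1..N. 2 * ratio * (2 * ratio) ^ (d - 1))"
    proof (intro sum.cong refl)
      fix d assume "d \<in> {1..N}"
      then obtain e where "d = Suc e" by (cases d) auto
      then show "2 ^ d * ratio ^ d = 2 * ratio * (2 * ratio) ^ (d - 1)"
        by (simp add: power_mult_distrib)
    qed
    also have "\<dots> = 2 * ratio * (\<Sum>d<N. (2 * ratio) ^ d)"
      unfolding sum_distrib_left[symmetric]
      by (rule arg_cong[where f = "(*) _"])
         (rule sum.reindex_bij_witness[of _ Suc "\<lambda>d. d - 1"], auto)
    also have "\<dots> \<le> 2 * ratio * 2"
    proof (intro mult_left_mono)
      have "(\<Sum>d<N. (2 * ratio) ^ d) \<le> (\<Sum>d<N. (1 / 2) ^ d)"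
        using r0 assms by (intro sum_mono power_mono) auto
      also have "\<dots> \<le> 2" by (simp add: sum_gp_strict)
      finally show "(\<Sum>d<N. (2 * ratio) ^ d) \<le> 2" .
    qed (use r0 in auto)
    finally show ?thesis by simp
  qed
  \<comment> \<open>The substitution \<open>i = d + 2\<close> turns the weight \<open>i - 1\<close>
    into \<open>d + 1\<close>.\<close>
  have "real (excess w) = (\<Sum>d=1..n - 2. real (d + 1) * real (count_list w (d + 2)))" for w
    unfolding excess_def of_nat_sum of_nat_mult
    by (rule sum.reindex_bij_witness[of _ "\<lambda>d. d + 2" "\<lambda>i. i - 2"])
       (auto simp flip: add_2_eq_Suc')
  then have "(\<Sum>w\<in>leaf_words. weight w * real (excess w))
      = (\<Sum>w\<in>leaf_words. \<Sum>d=1..n - 2. real (d + 1) * (weight w * real (count_list w (d + 2))))"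
    by (simp only: sum_distrib_left mult_ac)
  also have "\<dots> = (\<Sum>d=1..n - 2. real (d + 1) * (\<Sum>w\<in>leaf_words. weight w * real (count_list w (d + 2))))"
    unfolding sum_distrib_left by (rule sum.swap)
  also have "\<dots> \<le> (\<Sum>d=1..n - 2. real (d + 1) * (real k / pmf \<mu> 2 * ratio ^ d * total))"
    by (intro sum_mono mult_left_mono count_mean_le) auto
  also have "\<dots> = (\<Sum>d=1..n - 2. real (d + 1) * ratio ^ d) * (real k / pmf \<mu> 2 * total)"
    unfolding sum_distrib_right by (simp only: mult_ac)
  also have "\<dots> \<le> 4 * ratio * (real k / pmf \<mu> 2 * total)"
    using total by (intro mult_right_mono geom) auto
  finally show ?thesis by (simp add: mult_ac)
qed

text \<open>Markov's inequality for the weighted measure on \<open>leaf_words\<close>.\<close>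

lemma excess_tail_le:
  assumes "ratio \<le> 1 / 4" "\<delta> > 0"
  shows "(\<Sum>w | w \<in> leaf_words \<and> \<not> real (excess w) \<le> \<delta> * real k. weight w)
    \<le> 4 * ratio / (pmf \<mu> 2 * \<delta>) * total"
proof -
  have "\<delta> * real k * (\<Sum>w | w \<in> leaf_words \<and> \<not> real (excess w) \<le> \<delta> * real k. weight w)
      \<le> (\<Sum>w | w \<in> leaf_words \<and> \<not> real (excess w) \<le> \<delta> * real k. weight w * real (excess w))"
    unfolding sum_distrib_left mult.commute[of "\<delta> * real k"]
    by (intro sum_mono mult_left_mono weight_nonneg) auto
  also have "\<dots> \<le> (\<Sum>w\<in>leaf_words. weight w * real (excess w))"
    by (intro sum_mono2 finite_leaf_words) (auto simp: weight_nonneg)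
  also have "\<dots> \<le> 4 * ratio / pmf \<mu> 2 * real k * total"
    by (rule excess_mean_le[OF assms(1)])
  finally show ?thesis
    using assms(2) kn pos by (simp add: field_simps)
qed

text \<open>The conditioning event has positive probability, as witnessed by a word of excess zero:
  \<open>k\<close> zeros, \<open>k - 1\<close> letters 2 and letters 1 elsewhere.\<close>

lemma total_pos: "total > 0"
proof -
  define w where "w = replicate k (0::nat) @ replicate (k - 1) 2 @ replicate (n + 1 - 2 * k) 1"
  have "w \<in> leaf_words"
    using kn by (auto simp: w_def leaf_words_def words_def sum_list_replicate count_list_eq_length_filter)
  moreover have "weight w > 0"
    using pos by (auto simp: w_def weight_def)
  ultimately show ?thesis
    by (intro sum_pos2[of _ w] finite_leaf_words) (auto simp: weight_nonneg)
qed

end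

end

section \<open>Concentration\<close>

text \<open>The factor \<open>1 / n\<close> from Kemperman's formula is common to numerator and
  denominator and cancels, so the conditioned tree has the outdegrees of a weighted random
  word.\<close>

lemma cond_prob_size:
  fixes M :: "'w measure" and B :: "nat multiset \<Rightarrow> bool"
  assumes "prob_space M" "BGW_tree M \<mu> T" "n > 0"
  shows "\<P>(\<omega> in M. B (degs (T \<omega>)) \<bar> has_size n k (T \<omega>))
    = (\<Sum>w | w \<in> leaf_words n k \<and> B (mset w). weight \<mu> w) / (\<Sum>w\<in>leaf_words n k. weight \<mu> w)"
proof -
  have prob: "\<P>(\<omega> in M. C (degs (T \<omega>)) \<and> has_size n k (T \<omega>))
      = (\<Sum>w | w \<in> leaf_words n k \<and> C (mset w). weight \<mu> w) / real n" for C
  proof -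
    have "\<P>(\<omega> in M. C (degs (T \<omega>)) \<and> has_size n k (T \<omega>))
        = \<P>(\<omega> in M. finite (T \<omega>) \<and> card (T \<omega>) = n
            \<and> (C (degs (T \<omega>)) \<and> count (degs (T \<omega>)) 0 = k))"
      by (intro arg_cong[where f = "measure M"] Collect_cong) (auto simp: has_size_def count_degs)
    also have "\<dots> = (\<Sum>w | w \<in> words 1 n \<and> (C (mset w) \<and> count (mset w) 0 = k). weight \<mu> w) / real n"
      using prob_degs[OF assms, of "\<lambda>A. C A \<and> count A 0 = k"] by (simp add: weight_def)
    also have "{w. w \<in> words 1 n \<and> (C (mset w) \<and> count (mset w) 0 = k)}
        = {w. w \<in> leaf_words n k \<and> C (mset w)}"
      by (auto simp: leaf_words_def count_mset count_list_eq_length_filter)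
    finally show ?thesis .
  qed
  show ?thesis
    using prob[of B] prob[of "\<lambda>_. True"] assms(3) by (simp add: cond_prob_def)
qed

theorem theorem1p1:
  fixes \<mu> :: "nat pmf" and k :: "nat \<Rightarrow> nat"
    and M :: "'w measure" and T :: "'w \<Rightarrow> nat list set"
  assumes "pmf \<mu> 0 > 0" and "pmf \<mu> 1 > 0" and "pmf \<mu> 2 > 0"
    and "\<And>n. k n > 0"
    and "filterlim k at_top sequentially"
    and "(\<lambda>n. real (k n)) \<in> o(\<lambda>n. real n)"
    and "prob_space M"
    and "BGW_tree M \<mu> T"
  shows "\<forall>\<epsilon>>0. (\<lambda>n. \<P>(\<omega> in M.
      \<bar>real (\<phi> 2 (T \<omega>)) - real (k n)\<bar> \<le> \<epsilon> * real (k n)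
      \<and> \<bar>real (\<phi> 1 (T \<omega>)) - (real n - 2 * real (k n))\<bar> \<le> \<epsilon> * real (k n)
      \<bar> has_size n (k n) (T \<omega>))) \<longlonglongrightarrow> 1"
proof (intro allI impI)
  fix \<epsilon> :: real
  assume "\<epsilon> > 0"
  let ?P = "\<lambda>n. \<P>(\<omega> in M.
      \<bar>real (\<phi> 2 (T \<omega>)) - real (k n)\<bar> \<le> \<epsilon> * real (k n)
      \<and> \<bar>real (\<phi> 1 (T \<omega>)) - (real n - 2 * real (k n))\<bar> \<le> \<epsilon> * real (k n)
      \<bar> has_size n (k n) (T \<omega>))"
  let ?r = "\<lambda>n. ratio \<mu> n (k n)"
  have quot: "(\<lambda>n. real (k n) / real n) \<longlonglongrightarrow> 0"
    by (rule smalloD_tendsto[OF assms(6)])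
  have "(\<lambda>n. (real (k n) / real n) / (1 - 2 * (real (k n) / real n))) \<longlonglongrightarrow> 0 / (1 - 2 * 0)"
    by (intro tendsto_intros quot) simp
  then have "(\<lambda>n. pmf \<mu> 1 / pmf \<mu> 2 * ((real (k n) / real n) / (1 - 2 * (real (k n) / real n))))
      \<longlonglongrightarrow> pmf \<mu> 1 / pmf \<mu> 2 * (0 / (1 - 2 * 0))"
    by (rule tendsto_mult_left)
  moreover have "\<forall>\<^sub>F n in sequentially. pmf \<mu> 1 / pmf \<mu> 2
      * ((real (k n) / real n) / (1 - 2 * (real (k n) / real n))) = ?r n"
    using eventually_gt_at_top[of "0::nat"]
  proof eventually_elim
    case (elim n)
    then show ?case
      \<comment> \<open>If \<open>n = 2 * k n\<close>, both denominators vanish and both sides equal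
        0 by convention.\<close>
      by (cases "real n = 2 * real (k n)") (auto simp: ratio_def divide_simps)
  qed
  ultimately have r: "?r \<longlonglongrightarrow> 0"
    by (simp add: tendsto_cong)
  \<comment> \<open>The tail bound is used at level \<open>\<epsilon> / 2\<close>; the other half of
    \<open>\<epsilon>\<close> absorbs the additive constant 1 in the letter counts.\<close>
  let ?b = "\<lambda>n. 1 - 4 * ?r n / (pmf \<mu> 2 * (\<epsilon> / 2))"
  have "?b \<longlonglongrightarrow> 1 - 4 * 0 / (pmf \<mu> 2 * (\<epsilon> / 2))"
    using assms(3) \<open>\<epsilon> > 0\<close> by (intro tendsto_intros r) auto
  then have b: "?b \<longlonglongrightarrow> 1" by simp
  have "\<forall>\<^sub>F n in sequentially. ?r n \<le> 1 / 4"
    using order_tendstoD(2)[OF r, of "1 / 4"] by (auto elim: eventually_mono)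
  moreover have "\<forall>\<^sub>F n in sequentially. 3 * k n \<le> n"
  proof -
    have "\<forall>\<^sub>F n in sequentially. real (k n) / real n < 1 / 3"
      by (rule order_tendstoD(2)[OF quot]) simp
    then show ?thesis
      using eventually_gt_at_top[of "0::nat"] by eventually_elim (auto simp: divide_simps)
  qed
  moreover have "\<forall>\<^sub>F n in sequentially. 2 / \<epsilon> \<le> real (k n)"
    using filterlim_compose[OF filterlim_real_sequentially assms(5)]
    by (simp add: filterlim_at_top)
  ultimately have "\<forall>\<^sub>F n in sequentially. ?b n \<le> ?P n \<and> ?P n \<le> 1"
    using eventually_ge_at_top[of "2::nat"]
  proof eventually_elim
    case (elim n)
    let ?K = "real (k n)" and ?L = "leaf_words n (k n)"
    let ?B = "\<lambda>A. \<bar>real (count A 2) - ?K\<bar> \<le> \<epsilon> * ?K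
      \<and> \<bar>real (count A 1) - (real n - 2 * ?K)\<bar> \<le> \<epsilon> * ?K"
    let ?bad = "{w. w \<in> ?L \<and> \<not> real (excess n w) \<le> \<epsilon> / 2 * ?K}"
    let ?good = "{w. w \<in> ?L \<and> ?B (mset w)}"
    have k_pos: "0 < k n" by (rule assms(4))
    have total: "sum (weight \<mu>) ?L > 0"
      using total_pos[OF elim(2) k_pos assms(1-3)] .
    have P: "?P n = sum (weight \<mu>) ?good / sum (weight \<mu>) ?L"
    proof -
      have "?P n = \<P>(\<omega> in M. ?B (degs (T \<omega>)) \<bar> has_size n (k n) (T \<omega>))"
        unfolding cond_prob_def
        by (intro arg_cong2[where f = "(/)"] arg_cong[where f = "measure M"] Collect_cong refl)
           (auto simp: has_size_def count_degs)
      then show ?thesis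
        using cond_prob_size[OF assms(7,8), of n ?B "k n"] elim(4) by simp
    qed
    have good: "?B (mset w)" if "w \<in> ?L" "real (excess n w) \<le> \<epsilon> / 2 * ?K" for w
    proof -
      have c: "count (mset w) i = count_list w i" for i
        by (simp add: count_mset count_list_eq_length_filter)
      \<comment> \<open>With \<open>E\<close> the excess and \<open>R\<close> the number of letters
        above 2, the counts of 2 and of 1 are \<open>k - 1 - E\<close> and
        \<open>n - 2 * k + 1 + E - R\<close>, where \<open>0 \<le> R \<le> E\<close>; both
        deviations are at most \<open>E + 1\<close>. The growth of \<open>k\<close> makes the 1
        negligible.\<close>
      have "1 \<le> \<epsilon> / 2 * ?K"
        using elim(3) \<open>\<epsilon> > 0\<close> by (simp add: field_simps)
      moreover have "real (count_list w 2) + real (excess n w) + 1 = ?K"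
        using leaf_words_counts(1)[OF that(1) elim(4)] by linarith
      moreover have "real (count_list w 1) + real (count_list w 2)
          + real (\<Sum>i=3..n. count_list w i) + ?K = real n"
        using leaf_words_counts(2)[OF that(1) elim(4)] by linarith
      moreover have "real (\<Sum>i=3..n. count_list w i) \<le> real (excess n w)"
        by (intro of_nat_mono count_sum_le_excess)
      moreover have "0 \<le> real (\<Sum>i=3..n. count_list w i)" "0 \<le> real (excess n w)"
        by (rule of_nat_0_le_iff)+
      ultimately show ?thesis
        unfolding c using that(2) by linarith
    qed
    have fin: "finite ?L" by (rule finite_leaf_words)
    \<comment> \<open>The two sets cover \<open>?L\<close> but may overlap, which suffices for a
      lower bound on the weight of \<open>?good\<close>.\<close>
    have "sum (weight \<mu>) ?L \<le> sum (weight \<mu>) (?good \<union> ?bad)"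
      using good fin by (intro sum_mono2) (auto simp: weight_nonneg)
    also have "\<dots> \<le> sum (weight \<mu>) ?good + sum (weight \<mu>) ?bad"
    proof -
      have "finite ?good" "finite ?bad" using fin by simp_all
      moreover have "0 \<le> sum (weight \<mu>) (?good \<inter> ?bad)"
        by (intro sum_nonneg weight_nonneg)
      ultimately show ?thesis
        using sum.union_inter[of ?good ?bad "weight \<mu>"] by linarith
    qed
    also have "sum (weight \<mu>) ?bad \<le> 4 * ?r n / (pmf \<mu> 2 * (\<epsilon> / 2)) * sum (weight \<mu>) ?L"
      using \<open>\<epsilon> > 0\<close> by (intro excess_tail_le[OF elim(2) k_pos assms(1-3) elim(1)]) simp
    finally have "?b n * sum (weight \<mu>) ?L \<le> sum (weight \<mu>) ?good"
      by (simp add: algebra_simps)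
    then have "?b n \<le> ?P n"
      unfolding P using total by (simp add: pos_le_divide_eq)
    moreover have "sum (weight \<mu>) ?good \<le> sum (weight \<mu>) ?L"
      using fin by (intro sum_mono2) (auto simp: weight_nonneg)
    then have "?P n \<le> 1"
      unfolding P using total by simp
    ultimately show ?case by blast
  qed
  then show "?P \<longlonglongrightarrow> 1"
    by (intro tendsto_sandwich[OF _ _ b tendsto_const]) (auto elim: eventually_mono)
qed

end
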